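(* Let $J_3$ be the Flower snark on the $12$ vertices $x_0,x_1,x_{-1},y_0,y_1,y_{-1},z_0,z_1,z_{-1},v_0,v_1,v_{-1}$ whose $18$ edges are: $z_0v_0$, $z_0x_0$, $z_0y_0$, $v_0v_1$, $v_0v_{-1}$, $v_1v_{-1}$, $x_0x_1$, $x_0x_{-1}$, $y_0y_1$, $y_0y_{-1}$, $v_1z_1$, $v_{-1}z_{-1}$, $x_1z_1$, $y_1z_1$, $x_{-1}z_{-1}$, $y_{-1}z_{-1}$, $x_{-1}y_1$, $x_1y_{-1}$. Then $J_3$ is Class~$0$, i.e., its pebbling number is $\pi(J_3)=n(J_3)=12$.
   Context: A configuration $C$ on a graph $G$ assigns to each vertex $v$ a nonnegative integer $C(v)$ (number of pebbles). A pebbling move removes two pebbles from a vertex $v$ and places one pebble on a vertex adjacent to $v$. A configuration is $r$-solvable if some sequence of pebbling moves results in at least one pebble on the target vertex $r$. The pebbling number $\pi(G)$ is the minimum integer $t$ such that for every vertex $r$ of $G$, every configuration with $t$ pebbles in total is $r$-solvable. One always has $\pi(G)\ge n(G)$, the number of vertices, and $G$ is called Class~$0$ if $\pi(G)=n(G)$. The graph $J_3$ (also called Tietze's graph) is the Petersen graph with one vertex replaced by a triangle. *)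

theory Defs
  imports Main
begin

text \<open>A graph is given by a finite vertex set V and a symmetric irreflexive
adjacency relation E. A configuration is a function C :: 'a => nat, required
to vanish outside V.\<close>

definition is_config :: "'a set \<Rightarrow> ('a \<Rightarrow> nat) \<Rightarrow> bool" where
  "is_config V C \<longleftrightarrow> (\<forall>v. v \<notin> V \<longrightarrow> C v = 0)"

definition size_config :: "'a set \<Rightarrow> ('a \<Rightarrow> nat) \<Rightarrow> nat" where
  "size_config V C = (\<Sum>v\<in>V. C v)"

definition pebbling_move ::
  "'a set \<Rightarrow> ('a \<Rightarrow> 'a \<Rightarrow> bool) \<Rightarrow> ('a \<Rightarrow> nat) \<Rightarrow> ('a \<Rightarrow> nat) \<Rightarrow> bool" where
  "pebbling_move V E C C' \<longleftrightarrow>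
     (\<exists>v w. v \<in> V \<and> w \<in> V \<and> E v w \<and> 2 \<le> C v \<and>
            C' = C(v := C v - 2, w := C w + 1))"

definition solvable ::
  "'a set \<Rightarrow> ('a \<Rightarrow> 'a \<Rightarrow> bool) \<Rightarrow> ('a \<Rightarrow> nat) \<Rightarrow> 'a \<Rightarrow> bool" where
  "solvable V E C r \<longleftrightarrow>
     (\<exists>C'. (pebbling_move V E)\<^sup>*\<^sup>* C C' \<and> 1 \<le> C' r)"

definition pebbling_number :: "'a set \<Rightarrow> ('a \<Rightarrow> 'a \<Rightarrow> bool) \<Rightarrow> nat" where
  "pebbling_number V E =
     (LEAST t. \<forall>r\<in>V. \<forall>C. is_config V C \<and> size_config V C = t \<longrightarrow> solvable V E C r)"

datatype J3_vertex = X0 | X1 | Xm1 | Y0 | Y1 | Ym1 | Z0 | Z1 | Zm1 | V0 | V1 | Vm1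

definition J3_V :: "J3_vertex set" where
  "J3_V = {X0, X1, Xm1, Y0, Y1, Ym1, Z0, Z1, Zm1, V0, V1, Vm1}"

definition J3_edges :: "(J3_vertex \<times> J3_vertex) set" where
  "J3_edges = {(Z0,V0), (Z0,X0), (Z0,Y0), (V0,V1), (V0,Vm1), (V1,Vm1),
               (X0,X1), (X0,Xm1), (Y0,Y1), (Y0,Ym1), (V1,Z1), (Vm1,Zm1),
               (X1,Z1), (Y1,Z1), (Xm1,Zm1), (Ym1,Zm1), (Xm1,Y1), (X1,Ym1)}"

definition J3_adj :: "J3_vertex \<Rightarrow> J3_vertex \<Rightarrow> bool" where
  "J3_adj u v \<longleftrightarrow> (u, v) \<in> J3_edges \<or> (v, u) \<in> J3_edges"

end

theory Submission
  imports Defs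
begin

text \<open>
  Fix a root \<open>r\<close> and give weights to the vertices of a tree rooted at \<open>r\<close> that at least double
  towards the root. In a configuration from which \<open>r\<close> cannot be reached, the weighted number of
  pebbles is at most the total weight. These bounds alone leave some configurations with 12 pebbles
  on \<open>J\<^sub>3\<close>; but they also hold after any pebbling moves, which yields further inequalities valid where
  the vertices concerned carry enough pebbles. Distinguish how many pebbles single vertices carry, up
  to the symmetries of the graph that fix the root: each of the resulting cases is contradictory by a
  linear combination of such inequalities. By symmetry only the roots \<open>v\<^sub>0\<close>, \<open>z\<^sub>0\<close> and \<open>x\<^sub>0\<close> have to be
  treated. Conversely, with fewer than 12 pebbles there may be at most one on each vertex and none on
  the root.
\<close>

subsection \<open>Solvability\<close>

lemma solvable_if_pebbled:
  assumes "1 \<le> C r"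
  shows "solvable V E C r"
  using assms unfolding solvable_def by blast

lemma solvable_rtranclp:
  assumes "(pebbling_move V E)\<^sup>*\<^sup>* C D" "solvable V E D r"
  shows "solvable V E C r"
  using assms unfolding solvable_def by (blast intro: rtranclp_trans)

lemma pebbling_moveI:
  assumes "v \<in> V" "w \<in> V" "E v w" "2 \<le> C v"
  shows "pebbling_move V E C (C(v := C v - 2, w := C w + 1))"
  using assms unfolding pebbling_move_def by blast

lemma pebbling_move_embedding:
  assumes "inj_on \<phi> V" "\<phi> ` V \<subseteq> W"
    and hom: "\<And>v w. v \<in> V \<Longrightarrow> w \<in> V \<Longrightarrow> E v w \<Longrightarrow> F (\<phi> v) (\<phi> w)"
    and "pebbling_move V E D D'" and dominated: "\<forall>v\<in>V. D v \<le> C (\<phi> v)"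
  shows "\<exists>C'. pebbling_move W F C C' \<and> (\<forall>v\<in>V. D' v \<le> C' (\<phi> v))"
proof -
  obtain v w where move: "v \<in> V" "w \<in> V" "E v w" "2 \<le> D v"
    and D': "D' = D(v := D v - 2, w := D w + 1)"
    using assms(4) unfolding pebbling_move_def by blast
  let ?C' = "C(\<phi> v := C (\<phi> v) - 2, \<phi> w := C (\<phi> w) + 1)"
  have "2 \<le> C (\<phi> v)"
    using move(1,4) dominated by force
  then have "pebbling_move W F C ?C'"
    using assms(2) move hom by (intro pebbling_moveI) auto
  moreover have "D' u \<le> ?C' (\<phi> u)" if "u \<in> V" for u
    using that move(1,2) dominated assms(1) by (simp add: D' inj_on_eq_iff diff_le_mono)
  ultimately show ?thesis
    by blast
qed

lemma solvable_embedding: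
  assumes "inj_on \<phi> V" "\<phi> ` V \<subseteq> W"
    and "\<And>v w. v \<in> V \<Longrightarrow> w \<in> V \<Longrightarrow> E v w \<Longrightarrow> F (\<phi> v) (\<phi> w)"
    and "\<forall>v\<in>V. D v \<le> C (\<phi> v)" and "r \<in> V" "solvable V E D r"
  shows "solvable W F C (\<phi> r)"
proof -
  obtain D' where D': "(pebbling_move V E)\<^sup>*\<^sup>* D D'" "1 \<le> D' r"
    using assms(6) unfolding solvable_def by blast
  from D'(1) have "\<exists>C'. (pebbling_move W F)\<^sup>*\<^sup>* C C' \<and> (\<forall>v\<in>V. D' v \<le> C' (\<phi> v))"
  proof induction
    case base
    then show ?case
      using assms(4) by blast
  next
    case (step D' D'')
    then obtain C' where C': "(pebbling_move W F)\<^sup>*\<^sup>* C C'" "\<forall>v\<in>V. D' v \<le> C' (\<phi> v)"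
      by blast
    obtain C'' where "pebbling_move W F C' C''" "\<forall>v\<in>V. D'' v \<le> C'' (\<phi> v)"
      using pebbling_move_embedding[where E = E and F = F, OF assms(1,2) _ step.hyps(2) C'(2)] assms(3)
      by blast
    then show ?case
      using C'(1) rtranclp.rtrancl_into_rtrancl by metis
  qed
  then show ?thesis
    using D'(2) assms(5) unfolding solvable_def by (meson le_trans)
qed

corollary solvable_mono:
  assumes "\<forall>v\<in>V. D v \<le> C v" "r \<in> V" "solvable V E D r"
  shows "solvable V E C r"
  using solvable_embedding[of "\<lambda>v. v" V V E E D C r] assms by simp

definition automorphism :: "'a set \<Rightarrow> ('a \<Rightarrow> 'a \<Rightarrow> bool) \<Rightarrow> ('a \<Rightarrow> 'a) \<Rightarrow> bool" where
  "automorphism V E \<phi> \<longleftrightarrow> bij_betw \<phi> V V \<and> (\<forall>v\<in>V. \<forall>w\<in>V. E (\<phi> v) (\<phi> w) \<longleftrightarrow> E v w)"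

lemma automorphismI:
  assumes "finite V" "\<phi> ` V = V" "\<forall>v\<in>V. \<forall>w\<in>V. E (\<phi> v) (\<phi> w) \<longleftrightarrow> E v w"
  shows "automorphism V E \<phi>"
  using assms by (simp add: automorphism_def bij_betw_def eq_card_imp_inj_on)

lemma automorphism_id: "automorphism V E id"
  by (simp add: automorphism_def)

lemma automorphism_comp:
  assumes "automorphism V E \<phi>" "automorphism V E \<psi>"
  shows "automorphism V E (\<phi> \<circ> \<psi>)"
  using assms unfolding automorphism_def by (auto intro: bij_betw_trans dest: bij_betwE)

lemma automorphism_funpow:
  assumes "automorphism V E \<phi>"
  shows "automorphism V E (\<phi> ^^ k)"
  by (induction k) (simp_all add: automorphism_id[unfolded id_def] automorphism_comp assms del: comp_apply)

lemma size_config_automorphism: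
  assumes "automorphism V E \<phi>"
  shows "size_config V (C \<circ> \<phi>) = size_config V C"
  using assms unfolding automorphism_def size_config_def comp_def
  by (blast intro: sum.reindex_bij_betw)

lemma solvable_automorphism:
  assumes "automorphism V E \<phi>" "r \<in> V" "solvable V E (C \<circ> \<phi>) r"
  shows "solvable V E C (\<phi> r)"
proof (rule solvable_embedding[OF _ _ _ _ assms(2,3)])
  show "inj_on \<phi> V" "\<phi> ` V \<subseteq> V"
    using assms(1) by (simp_all add: automorphism_def bij_betw_def)
  show "E (\<phi> v) (\<phi> w)" if "v \<in> V" "w \<in> V" "E v w" for v w
    using assms(1) that by (simp add: automorphism_def)
qed simp

definition pebbles_suffice :: "'a set \<Rightarrow> ('a \<Rightarrow> 'a \<Rightarrow> bool) \<Rightarrow> nat \<Rightarrow> 'a \<Rightarrow> bool" where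
  "pebbles_suffice V E t r \<longleftrightarrow> (\<forall>C. size_config V C = t \<longrightarrow> solvable V E C r)"

lemma pebbles_suffice_automorphism:
  assumes "automorphism V E \<phi>" "r \<in> V" "pebbles_suffice V E t r"
  shows "pebbles_suffice V E t (\<phi> r)"
  using assms(3) solvable_automorphism[OF assms(1,2)] size_config_automorphism[OF assms(1)]
  unfolding pebbles_suffice_def by blast

lemma unsolvable_config_of_less_card:
  assumes "finite V" "r \<in> V" "t < card V"
  obtains C where "is_config V C" "size_config V C = t" "\<not> solvable V E C r"
proof -
  have "t \<le> card (V - {r})"
    using assms by simp
  then obtain S where S: "S \<subseteq> V - {r}" "card S = t"
    by (meson obtain_subset_with_card_n)
  define C :: "'a \<Rightarrow> nat" where "C v = (if v \<in> S then 1 else 0)" for v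
  have "C r = 0"
    using S(1) by (auto simp: C_def)
  have "\<not> pebbling_move V E C C'" for C'
    by (auto simp: pebbling_move_def C_def)
  then have "\<not> solvable V E C r"
    using \<open>C r = 0\<close> unfolding solvable_def by (metis converse_rtranclpE not_one_le_zero)
  moreover have "is_config V C"
    using S(1) by (auto simp: is_config_def C_def)
  moreover have "V \<inter> S = S"
    using S(1) by blast
  then have "size_config V C = t"
    using S(2) assms(1) by (simp add: size_config_def C_def sum.If_cases)
  ultimately show thesis
    using that by blast
qed

lemma pebbling_number_eq_card:
  assumes "finite V" and suffices: "\<And>r. r \<in> V \<Longrightarrow> pebbles_suffice V E (card V) r"
  shows "pebbling_number V E = card V"
  unfolding pebbling_number_def
proof (rule Least_equality)
  show "\<forall>r\<in>V. \<forall>C. is_config V C \<and> size_config V C = card V \<longrightarrow> solvable V E C r"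
    using suffices unfolding pebbles_suffice_def by blast
next
  fix t
  assume t_suffices: "\<forall>r\<in>V. \<forall>C. is_config V C \<and> size_config V C = t \<longrightarrow> solvable V E C r"
  show "card V \<le> t"
  proof (rule ccontr)
    assume "\<not> card V \<le> t"
    then have "t < card V"
      by simp
    then obtain r where "r \<in> V"
      by (cases "V = {}") auto
    then obtain C where "is_config V C" "size_config V C = t" "\<not> solvable V E C r"
      by (rule unsolvable_config_of_less_card[OF assms(1) _ \<open>t < card V\<close>])
    then show False
      using t_suffices \<open>r \<in> V\<close> by blast
  qed
qed

subsection \<open>Weight functions\<close>

locale pebbling_graph =
  fixes V :: "'a set" and E :: "'a \<Rightarrow> 'a \<Rightarrow> bool"
  assumes finite_V: "finite V"
    and adj_in_V: "E v w \<Longrightarrow> v \<in> V \<and> w \<in> V"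
    and adj_irrefl: "\<not> E v v"

definition total_weight :: "'a set \<Rightarrow> ('a \<Rightarrow> nat) \<Rightarrow> ('a \<Rightarrow> nat) \<Rightarrow> nat" where
  "total_weight V f C = (\<Sum>v\<in>V. f v * C v)"

definition weight_function :: "'a set \<Rightarrow> ('a \<Rightarrow> 'a \<Rightarrow> bool) \<Rightarrow> 'a \<Rightarrow> ('a \<Rightarrow> nat) \<Rightarrow> bool" where
  "weight_function V E r f \<longleftrightarrow>
     (\<forall>v\<in>V. 0 < f v \<longrightarrow> (\<exists>p\<in>V. E v p \<and> (p = r \<or> 2 * f v \<le> f p)))"

context pebbling_graph
begin

lemma total_weight_pebbling_move:
  assumes "E v w" "2 \<le> C v"
  shows "total_weight V f (C(v := C v - 2, w := C w + 1)) + 2 * f v = total_weight V f C + f w"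
proof -
  let ?D = "C(v := C v - 2, w := C w + 1)"
  have endpoints: "v \<in> V" "w \<in> V" "v \<noteq> w"
    using assms(1) adj_in_V adj_irrefl by auto
  then have split: "sum g V = g v + g w + sum g (V - {v} - {w})" for g :: "'a \<Rightarrow> nat"
    using finite_V sum.remove[of V v g] sum.remove[of "V - {v}" w g] by simp
  have rest: "(\<Sum>u\<in>V - {v} - {w}. f u * ?D u) = (\<Sum>u\<in>V - {v} - {w}. f u * C u)"
    by (rule sum.cong) auto
  have "f v * (C v - 2) + 2 * f v = f v * C v"
    using assms(2) by (simp add: diff_mult_distrib2)
  then show ?thesis
    using endpoints(3) by (simp add: total_weight_def split rest)
qed

lemma size_config_pebbling_move:
  assumes "E v w" "2 \<le> C v"
  shows "size_config V (C(v := C v - 2, w := C w + 1)) < size_config V C"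
  using total_weight_pebbling_move[where f = "\<lambda>_. 1", of v w C] assms
  by (simp add: total_weight_def size_config_def)

text \<open>Some vertex of positive weight carries two pebbles; moving them towards the root does not
  decrease the total weight but uses up a pebble.\<close>

lemma solvable_if_weight_less:
  assumes weights: "weight_function V E r f" and "sum f V < total_weight V f C"
  shows "solvable V E C r"
  using assms(2)
proof (induction "size_config V C" arbitrary: C rule: less_induct)
  case less
  obtain v where heavy: "v \<in> V" "f v < f v * C v"
    using sum_mono[of V "\<lambda>v. f v * C v" f] less.prems unfolding total_weight_def
    by (meson leD leI)
  then have "0 < f v" "2 \<le> C v"
    by (auto simp: Suc_le_eq numeral_2_eq_2 intro: gr0I)
  then obtain p where parent: "p \<in> V" "E v p" "p = r \<or> 2 * f v \<le> f p"
    using weights heavy(1) unfolding weight_function_def by blast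
  let ?D = "C(v := C v - 2, p := C p + 1)"
  have "solvable V E ?D r"
  proof (cases "p = r")
    case True
    then show ?thesis
      by (simp add: solvable_if_pebbled)
  next
    case False
    then have "sum f V < total_weight V f ?D"
      using total_weight_pebbling_move[of v p C f] \<open>2 \<le> C v\<close> parent(2,3) less.prems by linarith
    then show ?thesis
      using less.hyps size_config_pebbling_move[of v p C] \<open>2 \<le> C v\<close> parent(2) by blast
  qed
  with pebbling_moveI[where E = E and C = C, OF heavy(1) parent(1,2) \<open>2 \<le> C v\<close>] show ?case
    by (rule solvable_rtranclp[OF r_into_rtranclp])
qed

end

text \<open>A weight function supported on a tree is encoded by the levels of the tree below its root.\<close>

fun level_weight :: "'a list list \<Rightarrow> 'a \<Rightarrow> nat" where
  "level_weight [] v = 0"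
| "level_weight (S # Ss) v = (if v \<in> set S then 2 ^ length Ss else level_weight Ss v)"

fun levels_below :: "('a \<Rightarrow> 'a \<Rightarrow> bool) \<Rightarrow> 'a list \<Rightarrow> 'a list list \<Rightarrow> bool" where
  "levels_below E P [] \<longleftrightarrow> True"
| "levels_below E P (S # Ss) \<longleftrightarrow> (\<forall>v\<in>set S. \<exists>p\<in>set P. E v p) \<and> levels_below E S Ss"

lemma double_level_weight_le: "2 * level_weight Ss v \<le> 2 ^ length Ss"
  by (induction Ss) auto

lemma levels_below_parent:
  assumes "levels_below E P Ss" "0 < level_weight Ss v"
  shows "\<exists>p. E v p \<and> (p \<in> set P \<or> 2 * level_weight Ss v \<le> level_weight Ss p)"
  using assms
proof (induction Ss arbitrary: P)
  case (Cons S Ss)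
  show ?case
  proof (cases "v \<in> set S")
    case True
    then show ?thesis
      using Cons.prems(1) by auto
  next
    case False
    then obtain p where "E v p" "p \<in> set S \<or> 2 * level_weight Ss v \<le> level_weight Ss p"
      using Cons by auto
    then have "2 * level_weight (S # Ss) v \<le> level_weight (S # Ss) p"
      using False double_level_weight_le[of Ss v] by auto
    then show ?thesis
      using \<open>E v p\<close> by blast
  qed
qed simp

lemma (in pebbling_graph) weight_function_level_weight:
  assumes "levels_below E [r] Ss"
  shows "weight_function V E r (level_weight Ss)"
  unfolding weight_function_def
proof (intro ballI impI)
  fix v assume "0 < level_weight Ss v"
  then obtain p where "E v p" "p = r \<or> 2 * level_weight Ss v \<le> level_weight Ss p"
    using levels_below_parent[OF assms] by auto
  then show "\<exists>p\<in>V. E v p \<and> (p = r \<or> 2 * level_weight Ss v \<le> level_weight Ss p)"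
    using adj_in_V by blast
qed

subsection \<open>Certificates\<close>

fun apply_moves :: "('a \<Rightarrow> 'a \<Rightarrow> bool) \<Rightarrow> ('a \<times> 'a) list \<Rightarrow> ('a \<Rightarrow> nat) \<Rightarrow> ('a \<Rightarrow> nat) option" where
  "apply_moves E [] L = Some L"
| "apply_moves E ((v, w) # ms) L =
     (if E v w \<and> 2 \<le> L v then apply_moves E ms (L(v := L v - 2, w := L w + 1)) else None)"

lemma (in pebbling_graph) apply_moves_rtranclp:
  assumes "apply_moves E ms L = Some L'"
  shows "(pebbling_move V E)\<^sup>*\<^sup>* (\<lambda>v. L v + R v) (\<lambda>v. L' v + R v)"
  using assms
proof (induction ms arbitrary: L)
  case (Cons m ms)
  obtain v w where m_eq: "m = (v, w)"
    by fastforce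
  let ?L = "L(v := L v - 2, w := L w + 1)" and ?C = "\<lambda>v. L v + R v"
  have move: "E v w" "2 \<le> L v" and "apply_moves E ms ?L = Some L'"
    using Cons.prems by (auto simp: m_eq split: if_splits)
  have "?C(v := ?C v - 2, w := ?C w + 1) = (\<lambda>u. ?L u + R u)"
    using move adj_irrefl by auto
  moreover have "pebbling_move V E ?C (?C(v := ?C v - 2, w := ?C w + 1))"
    using move adj_in_V by (intro pebbling_moveI) auto
  ultimately have "pebbling_move V E ?C (\<lambda>u. ?L u + R u)"
    by (simp only:)
  then show ?case
    using Cons.IH[OF \<open>apply_moves E ms ?L = Some L'\<close>] by (rule converse_rtranclp_into_rtranclp)
qed simp

text \<open>Weak duality of linear programming for the objective \<open>m * sum R V\<close>: where the combination has
  a coefficient smaller than \<open>m\<close>, the bound \<open>U\<close> on the variable makes up for the difference.\<close>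

lemma combination_bound:
  fixes f :: "'b \<Rightarrow> 'a \<Rightarrow> nat" and c d b :: "'b \<Rightarrow> nat"
  assumes constraints: "\<And>x. x \<in> set xs \<Longrightarrow> d x + total_weight V (f x) R \<le> b x"
    and "\<And>v. v \<in> V \<Longrightarrow> R v \<le> U v"
  shows "(\<Sum>x\<leftarrow>xs. c x * d x) + m * sum R V
    \<le> (\<Sum>x\<leftarrow>xs. c x * b x) + (\<Sum>v\<in>V. (m - (\<Sum>x\<leftarrow>xs. c x * f x v)) * U v)"
proof -
  define a where "a v = (\<Sum>x\<leftarrow>xs. c x * f x v)" for v
  have swap: "(\<Sum>v\<in>V. a v * R v) = (\<Sum>x\<leftarrow>xs. c x * total_weight V (f x) R)"
    unfolding a_def total_weight_def
    by (induction xs) (simp_all add: sum.distrib distrib_right sum_distrib_left mult.assoc)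
  have "m * R v \<le> a v * R v + (m - a v) * U v" if "v \<in> V" for v
  proof -
    have "m * R v \<le> (a v + (m - a v)) * R v"
      by (intro mult_le_mono1) simp
    also have "\<dots> \<le> a v * R v + (m - a v) * U v"
      using assms(2)[OF that] by (simp add: distrib_right)
    finally show ?thesis .
  qed
  then have "m * sum R V \<le> (\<Sum>v\<in>V. a v * R v) + (\<Sum>v\<in>V. (m - a v) * U v)"
    unfolding sum_distrib_left sum.distrib[symmetric] by (intro sum_mono)
  moreover have "(\<Sum>x\<leftarrow>xs. c x * d x) + (\<Sum>v\<in>V. a v * R v) \<le> (\<Sum>x\<leftarrow>xs. c x * b x)"
    unfolding swap sum_list_addf[symmetric] distrib_left[symmetric]
    by (intro sum_list_mono mult_le_mono2 constraints)
  ultimately show ?thesis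
    unfolding a_def by linarith
qed

definition box :: "'a set \<Rightarrow> ('a \<Rightarrow> nat) \<Rightarrow> ('a \<Rightarrow> nat) \<Rightarrow> ('a \<Rightarrow> nat) set" where
  "box V lo hi = {C. \<forall>v\<in>V. lo v \<le> C v \<and> C v \<le> hi v}"

definition box_orbit ::
  "'a set \<Rightarrow> ('a \<Rightarrow> 'a) list \<Rightarrow> ('a \<Rightarrow> nat) \<Rightarrow> ('a \<Rightarrow> nat) \<Rightarrow> 'a \<Rightarrow> 'a list" where
  "box_orbit V A lo hi v =
     map (\<lambda>\<phi>. \<phi> v) (filter (\<lambda>\<phi>. \<forall>u\<in>V. lo (\<phi> u) = lo u \<and> hi (\<phi> u) = hi u) A)"

definition cap_orbit ::
  "'a set \<Rightarrow> ('a \<Rightarrow> 'a) list \<Rightarrow> ('a \<Rightarrow> nat) \<Rightarrow> ('a \<Rightarrow> nat) \<Rightarrow> 'a \<Rightarrow> nat \<Rightarrow> 'a \<Rightarrow> nat" where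
  "cap_orbit V A lo hi v k = fold (\<lambda>u h. h(u := k)) (box_orbit V A lo hi v) hi"

lemma box_split_cases:
  assumes in_box: "C \<in> box V lo hi" and closed: "\<forall>\<phi>\<in>set A. \<phi> ` V \<subseteq> V"
  obtains (low) "C \<in> box V lo (cap_orbit V A lo hi v k)"
  | (high) \<phi> where "\<phi> \<in> set A" "C \<circ> \<phi> \<in> box V (lo(v := Suc k)) hi"
proof (cases "\<forall>u\<in>set (box_orbit V A lo hi v). C u \<le> k")
  case True
  have "fold (\<lambda>u h. h(u := k)) us hi u = (if u \<in> set us then k else hi u)" for us u
    by (induction us arbitrary: hi) auto
  then show thesis
    using True in_box low by (simp add: box_def cap_orbit_def)
next
  case False
  then obtain \<phi> where exceeds: "\<phi> \<in> set A" "k < C (\<phi> v)"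
    and invariant: "\<forall>u\<in>V. lo (\<phi> u) = lo u \<and> hi (\<phi> u) = hi u"
    by (force simp: box_orbit_def)
  have "\<phi> u \<in> V" if "u \<in> V" for u
    using closed exceeds(1) that by blast
  then have "C \<circ> \<phi> \<in> box V (lo(v := Suc k)) hi"
    using in_box exceeds(2) invariant unfolding box_def by fastforce
  then show thesis
    using exceeds(1) high by blast
qed

text \<open>\<open>Split v k\<close> distinguishes whether all vertices in the orbit of \<open>v\<close> under the symmetries of the
  box carry at most \<open>k\<close> pebbles; if not, then by symmetry \<open>v\<close> may be assumed to carry more. A triple
  \<open>(c, ms, Ss)\<close> in a leaf stands for \<open>c\<close> times the weight bound of the levels \<open>Ss\<close> after the moves
  \<open>ms\<close>, which use only the pebbles guaranteed by the lower corner of the box; the leaf compares the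
  sum of these with \<open>m\<close> times the equation for the number of pebbles.\<close>

datatype 'a certificate =
    Split 'a nat "'a certificate" "'a certificate"
  | Leaf nat "(nat \<times> ('a \<times> 'a) list \<times> 'a list list) list"

primrec refutes ::
  "'a set \<Rightarrow> ('a \<Rightarrow> 'a \<Rightarrow> bool) \<Rightarrow> ('a \<Rightarrow> 'a) list \<Rightarrow> 'a \<Rightarrow> nat \<Rightarrow> ('a \<Rightarrow> nat) \<Rightarrow> ('a \<Rightarrow> nat) \<Rightarrow>
    'a certificate \<Rightarrow> bool" where
  "refutes V E A r n lo hi (Split v k cert_low cert_high) \<longleftrightarrow>
     refutes V E A r n lo (cap_orbit V A lo hi v k) cert_low \<and>
     refutes V E A r n (lo(v := Suc k)) hi cert_high"
| "refutes V E A r n lo hi (Leaf m xs) \<longleftrightarrow>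
     (\<forall>(c, ms, Ss)\<in>set xs. levels_below E [r] Ss \<and> apply_moves E ms lo \<noteq> None) \<and>
     (\<Sum>(c, ms, Ss)\<leftarrow>xs. c * sum (level_weight Ss) V) +
     (\<Sum>v\<in>V. (m - (\<Sum>(c, ms, Ss)\<leftarrow>xs. c * level_weight Ss v)) * (hi v - lo v)) + m * sum lo V
     < (\<Sum>(c, ms, Ss)\<leftarrow>xs. c * total_weight V (level_weight Ss) (the (apply_moves E ms lo))) + m * n"

context pebbling_graph
begin

lemma weight_bound_after_moves:
  assumes "weight_function V E r f" and moves: "apply_moves E ms L = Some L'"
    and unsolvable: "\<not> solvable V E (\<lambda>v. L v + R v) r"
  shows "total_weight V f L' + total_weight V f R \<le> sum f V"
proof -
  have "\<not> solvable V E (\<lambda>v. L' v + R v) r"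
    using solvable_rtranclp[OF apply_moves_rtranclp[OF moves]] unsolvable by blast
  then have "total_weight V f (\<lambda>v. L' v + R v) \<le> sum f V"
    using solvable_if_weight_less[OF assms(1)] not_le by blast
  then show ?thesis
    by (simp add: total_weight_def distrib_left sum.distrib)
qed

lemma solvable_if_refutes_Leaf:
  assumes leaf: "refutes V E A r n lo hi (Leaf m xs)" and "r \<in> V"
    and in_box: "C \<in> box V lo hi" and "size_config V C = n"
  shows "solvable V E C r"
proof (rule ccontr)
  assume unsolvable: "\<not> solvable V E C r"
  define R where "R v = C v - lo v" for v
  let ?f = level_weight and ?L = "\<lambda>ms. the (apply_moves E ms lo)"
  have lo_R: "C v = lo v + R v" if "v \<in> V" for v
    using in_box that by (auto simp: box_def R_def)
  then have unsolvable_lo_R: "\<not> solvable V E (\<lambda>v. lo v + R v) r"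
    using solvable_mono[of V "\<lambda>v. lo v + R v" C r E] \<open>r \<in> V\<close> unsolvable by auto
  have "total_weight V (?f Ss) (?L ms) + total_weight V (?f Ss) R \<le> sum (?f Ss) V"
    if "(c, ms, Ss) \<in> set xs" for c ms Ss
  proof (rule weight_bound_after_moves[OF _ _ unsolvable_lo_R])
    show "weight_function V E r (?f Ss)" "apply_moves E ms lo = Some (?L ms)"
      using leaf that by (auto intro: weight_function_level_weight)
  qed
  then have "(\<Sum>(c, ms, Ss)\<leftarrow>xs. c * total_weight V (?f Ss) (?L ms)) + m * sum R V
      \<le> (\<Sum>(c, ms, Ss)\<leftarrow>xs. c * sum (?f Ss) V) +
        (\<Sum>v\<in>V. (m - (\<Sum>(c, ms, Ss)\<leftarrow>xs. c * ?f Ss v)) * (hi v - lo v))"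
    using combination_bound[where xs = xs and R = R and V = V and m = m and c = fst
        and U = "\<lambda>v. hi v - lo v" and f = "\<lambda>(c, ms, Ss). ?f Ss"
        and d = "\<lambda>(c, ms, Ss). total_weight V (?f Ss) (?L ms)" and b = "\<lambda>(c, ms, Ss). sum (?f Ss) V"]
      in_box by (force simp: R_def box_def split_def diff_le_mono)
  moreover have "m * n = m * sum lo V + m * sum R V"
    using \<open>size_config V C = n\<close> by (simp add: size_config_def lo_R sum.distrib flip: distrib_left)
  ultimately show False
    using leaf by simp
qed

lemma solvable_if_refutes:
  assumes "refutes V E A r n lo hi cert"
    and symmetries: "\<And>\<phi>. \<phi> \<in> set A \<Longrightarrow> automorphism V E \<phi> \<and> \<phi> r = r" and "r \<in> V"
    and "C \<in> box V lo hi" "size_config V C = n"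
  shows "solvable V E C r"
  using assms(1,4,5)
proof (induction cert arbitrary: lo hi C)
  case (Leaf m xs)
  then show ?case
    using solvable_if_refutes_Leaf \<open>r \<in> V\<close> by blast
next
  case (Split v k cert_low cert_high)
  then have refutes_low: "refutes V E A r n lo (cap_orbit V A lo hi v k) cert_low"
    and refutes_high: "refutes V E A r n (lo(v := Suc k)) hi cert_high"
    by simp_all
  have closed: "\<forall>\<phi>\<in>set A. \<phi> ` V \<subseteq> V"
    using symmetries by (simp add: automorphism_def bij_betw_def)
  from Split.prems(2) closed show ?case
  proof (cases rule: box_split_cases[where v = v and k = k])
    case low
    then show ?thesis
      using Split.IH(1) refutes_low Split.prems(3) by blast
  next
    case (high \<phi>)
    then have aut: "automorphism V E \<phi>" and "\<phi> r = r"
      using symmetries by blast+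
    have "size_config V (C \<circ> \<phi>) = n"
      using Split.prems(3) size_config_automorphism[OF aut] by simp
    then have "solvable V E (C \<circ> \<phi>) r"
      using Split.IH(2) refutes_high high(2) by blast
    then show ?thesis
      using solvable_automorphism[OF aut \<open>r \<in> V\<close>] \<open>\<phi> r = r\<close> by metis
  qed
qed

theorem pebbles_suffice_if_refutes:
  assumes "refutes V E A r n (\<lambda>_. 0) ((\<lambda>_. n)(r := 0)) cert"
    and "\<And>\<phi>. \<phi> \<in> set A \<Longrightarrow> automorphism V E \<phi> \<and> \<phi> r = r" and "r \<in> V"
  shows "pebbles_suffice V E n r"
  unfolding pebbles_suffice_def
proof (intro allI impI)
  fix C assume size: "size_config V C = n"
  show "solvable V E C r"
  proof (cases "C r = 0")
    case True
    then have "C \<in> box V (\<lambda>_. 0) ((\<lambda>_. n)(r := 0))"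
      using size finite_V by (auto simp: box_def size_config_def intro: member_le_sum)
    then show ?thesis
      using solvable_if_refutes[OF assms] size by blast
  next
    case False
    then show ?thesis
      by (simp add: solvable_if_pebbled)
  qed
qed

end

subsection \<open>The flower snark\<close>

fun J3_neighbours :: "J3_vertex \<Rightarrow> J3_vertex list" where
  "J3_neighbours X0 = [Z0, X1, Xm1]" | "J3_neighbours X1 = [X0, Z1, Ym1]"
| "J3_neighbours Xm1 = [X0, Zm1, Y1]" | "J3_neighbours Y0 = [Z0, Y1, Ym1]"
| "J3_neighbours Y1 = [Y0, Z1, Xm1]" | "J3_neighbours Ym1 = [Y0, Zm1, X1]"
| "J3_neighbours Z0 = [V0, X0, Y0]" | "J3_neighbours Z1 = [V1, X1, Y1]"
| "J3_neighbours Zm1 = [Vm1, Xm1, Ym1]" | "J3_neighbours V0 = [Z0, V1, Vm1]"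
| "J3_neighbours V1 = [V0, Vm1, Z1]" | "J3_neighbours Vm1 = [V0, V1, Zm1]"

lemma J3_adj_code [code]: "J3_adj v w \<longleftrightarrow> w \<in> set (J3_neighbours v)"
  by (cases v; cases w) (simp_all add: J3_adj_def J3_edges_def)

lemma in_J3_V: "v \<in> J3_V"
  by (cases v) (simp_all add: J3_V_def)

interpretation J3: pebbling_graph J3_V J3_adj
proof
  show "finite J3_V"
    by (simp add: J3_V_def)
  show "\<not> J3_adj v v" for v
    by (cases v) (simp_all add: J3_adj_code)
qed (simp add: in_J3_V)

text \<open>The six vertices \<open>x\<^sub>i\<close>, \<open>y\<^sub>i\<close> form a hexagon; its symmetries extend to the graph.\<close>

fun J3_rotate :: "J3_vertex \<Rightarrow> J3_vertex" where
  "J3_rotate X0 = X1" | "J3_rotate X1 = Ym1" | "J3_rotate Ym1 = Y0"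
| "J3_rotate Y0 = Y1" | "J3_rotate Y1 = Xm1" | "J3_rotate Xm1 = X0"
| "J3_rotate Z0 = Z1" | "J3_rotate Z1 = Zm1" | "J3_rotate Zm1 = Z0"
| "J3_rotate V0 = V1" | "J3_rotate V1 = Vm1" | "J3_rotate Vm1 = V0"

fun J3_reflect :: "J3_vertex \<Rightarrow> J3_vertex" where
  "J3_reflect X0 = X0" | "J3_reflect X1 = Xm1" | "J3_reflect Xm1 = X1"
| "J3_reflect Y0 = Y0" | "J3_reflect Y1 = Ym1" | "J3_reflect Ym1 = Y1"
| "J3_reflect Z0 = Z0" | "J3_reflect Z1 = Zm1" | "J3_reflect Zm1 = Z1"
| "J3_reflect V0 = V0" | "J3_reflect V1 = Vm1" | "J3_reflect Vm1 = V1"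

lemma automorphism_J3_rotate: "automorphism J3_V J3_adj J3_rotate"
  by (rule automorphismI[OF J3.finite_V]; code_simp)

lemma automorphism_J3_reflect: "automorphism J3_V J3_adj J3_reflect"
  by (rule automorphismI[OF J3.finite_V]; code_simp)

lemmas automorphisms_J3 =
  automorphism_J3_rotate automorphism_J3_reflect automorphism_id automorphism_comp automorphism_funpow

text \<open>The stabilizer of \<open>z\<^sub>0\<close> and of \<open>v\<^sub>0\<close>.\<close>

definition J3_stabilizer :: "(J3_vertex \<Rightarrow> J3_vertex) list" where
  "J3_stabilizer = [id, J3_rotate ^^ 3, J3_reflect, J3_reflect \<circ> (J3_rotate ^^ 3)]"

definition certificate_Z0 :: "J3_vertex certificate" where
  "certificate_Z0 =
   Split V0 0
    (Split Z1 2
     (Leaf 15 [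
        (1, [], [[X0], [X1, Xm1], [Y1, Ym1, Z1, Zm1], [Vm1], [V1]]),
        (2, [], [[Y0], [Y1, Ym1], [X1, Xm1, Z1, Zm1], [V1, Vm1]]),
        (3, [], [[V0], [V1, Vm1], [Z1, Zm1], [X1, Xm1, Y1, Ym1]])])
     (Split X1 0
      (Leaf 8 [
         (1, [], [[V0], [V1, Vm1], [Z1, Zm1], [Xm1, Ym1], [Y1]]),
         (2, [], [[Y0], [Y1, Ym1], [Xm1, Z1, Zm1]]),
         (2, [], [[X0], [X1, Xm1], [Ym1, Z1, Zm1]])])
      (Leaf 38 [
         (6, [(Z1, V1)], [[V0], [V1, Vm1], [Z1, Zm1], [X1, Ym1]]),
         (5, [], [[X0], [X1], [Z1], [V1]]),
         (4, [(Z1, X1), (X1, X0)], [[X0], [Xm1], [Y1, Zm1], [Ym1, Z1, Vm1], [V1]]),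
         (6, [], [[Y0], [Y1, Ym1], [X1, Z1, Zm1], [Xm1, V1, Vm1]])])))
    (Leaf 7 [
       (1, [], [[Y0], [Y1, Ym1], [Xm1, Z1, Zm1], [X1]]),
       (1, [], [[X0], [X1, Xm1], [Y1, Ym1, Z1], [Zm1]]),
       (1, [], [[V0], [V1, Vm1], [Z1, Zm1], [X1, Y1], [Xm1, Ym1]])])"

definition certificate_X0 :: "J3_vertex certificate" where
  "certificate_X0 =
   Split Z1 1
    (Split X1 0
     (Split V1 1
      (Leaf 9 [
         (1, [], [[Z0], [Y0, V0], [Y1, Ym1], [Zm1], [Vm1]]),
         (1, [], [[X1], [Ym1, Z1], [Y1, Zm1, V1], [Y0]]),
         (1, [], [[Xm1], [Y1, Zm1], [Ym1, Vm1], [V0]])])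
      (Split Z1 0
       (Split V1 3
        (Leaf 4 [
           (1, [], [[Xm1], [Y1, Zm1], [Ym1, Vm1], [V1]]),
           (2, [], [[Z0], [Y0, V0], [Ym1, V1, Vm1]])])
        (Leaf 24 [
           (1, [(V1, Z1), (V1, Z1), (Z1, Y1)], [[Xm1], [Y1, Zm1], [Vm1], [V1]]),
           (2, [], [[X1], [Z1], [Y1, V1], [Vm1], [Zm1]]),
           (6, [], [[Z0], [Y0, V0], [Y1, V1, Vm1], [Zm1]]),
           (3, [(V1, Z1), (V1, Z1), (Z1, X1)], [[X1], [Ym1], [Zm1], [Vm1], [V1]])]))
       (Leaf 24 [
          (1, [(V1, Z1), (Z1, Y1)], [[Xm1], [Y1, Zm1], [Vm1], [V1]]),
          (6, [], [[Z0], [Y0, V0], [Y1, V1, Vm1], [Zm1]]),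
          (3, [(V1, Z1), (Z1, X1)], [[X1], [Ym1], [Zm1], [Vm1], [V1]]),
          (4, [], [[X1], [Z1], [Y1, V1], [Vm1]])])))
     (Leaf 8 [
        (1, [], [[X1], [Ym1], [Zm1], [Vm1], [V1]]),
        (1, [], [[Xm1], [Y1, Zm1], [Y0, Vm1], [V0, V1]]),
        (3, [], [[Z0], [Y0, V0], [V1, Vm1]]),
        (2, [], [[X1], [Z1], [Y1, V1], [V0, Vm1]])]))
    (Leaf 8 [
       (1, [(Z1, X1)], [[X1], [Ym1], [Zm1], [Vm1], [V0, V1]]),
       (1, [(Z1, Y1)], [[Xm1], [Y1, Zm1], [Y0, Vm1], [V0, V1]]),
       (2, [(Z1, V1)], [[Z0], [Y0, V0], [V1, Vm1]]),
       (2, [], [[X1], [Z1], [Y1, V1], [Y0, V0, Vm1]])])"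

definition certificate_V0 :: "J3_vertex certificate" where
  "certificate_V0 =
   Split Z1 2
    (Split X0 1
     (Split Z0 0
      (Split X1 5
       (Split X0 0
        (Split X1 2
         (Leaf 5 [
            (1, [], [[Vm1], [Zm1], [Xm1, Ym1], [X1, Y1], [Z1]]),
            (1, [], [[V1], [Z1], [X1, Y1], [Xm1, Ym1]])])
         (Split Ym1 1
          (Leaf 12 [
             (4, [], [[V1], [Z1], [X1, Y1], [Xm1]]),
             (1, [], [[Z0], [X0], [X1, Xm1], [Y1, Ym1]]),
             (3, [], [[Vm1], [Zm1], [Xm1, Ym1], [X1, Y1]])])
          (Leaf 12 [
             (1, [], [[Z0], [X0], [X1, Xm1], [Y1, Ym1]]),
             (3, [], [[V1], [Z1], [X1, Y1], [Xm1, Ym1]]),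
             (3, [(X1, Ym1), (Ym1, Zm1)], [[Vm1], [Zm1], [Xm1, Ym1], [X1, Y1]]),
             (1, [(X1, X0), (Ym1, X1), (X1, X0), (X0, Z0)], [[Z0], [Y0], [Y1, Ym1], [X1, Xm1]])])))
        (Split X1 1
         (Split Y1 1
          (Leaf 8 [
             (1, [], [[V1], [Z1, Vm1], [Y1], [Xm1], [Zm1]])])
          (Split Xm1 0
           (Split Ym1 1
            (Leaf 16 [
               (1, [], [[Vm1], [Zm1], [Ym1], [Y0], [Y1]]),
               (3, [], [[Z0], [Y0], [Y1, Ym1], [Zm1]]),
               (2, [], [[V1], [Z1], [X1, Y1], [X0, Ym1], [Zm1]])])
            (Leaf 28 [
               (3, [], [[V1], [Z1], [X1, Y1], [Ym1], [Zm1]]),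
               (2, [], [[Vm1], [Zm1], [Ym1], [Y0], [Y1]]),
               (2, [(Y1, Y0), (Ym1, Y0), (Y0, Z0)], [[Z0], [X0], [X1], [Ym1, Z1], [Y1, Zm1]]),
               (6, [], [[Z0], [Y0], [Y1, Ym1], [X1, Zm1]])]))
           (Leaf 13 [
              (2, [(Y1, Xm1), (Xm1, X0), (X0, Z0)], [[Z0], [Y0], [Y1, Ym1], [Z1, Zm1], [X1]]),
              (1, [], [[Vm1], [Zm1], [Xm1, Ym1], [Y1], [Z1]]),
              (1, [], [[V1], [Z1], [X1, Y1], [Ym1], [Zm1]])])))
         (Split Ym1 0
          (Leaf 25 [
             (2, [], [[V1], [Z1], [X1, Y1], [Xm1], [Zm1]]),
             (2, [], [[Vm1], [Zm1], [Xm1], [X0], [X1]]),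
             (3, [], [[Z0], [X0], [X1, Xm1], [Y1, Zm1], [Z1]]),
             (3, [(X1, X0), (X0, Z0)], [[Z0], [Y0], [Y1], [Z1], [X1]])])
          (Leaf 112 [
             (10, [], [[Z0], [X0], [X1, Xm1], [Y1, Ym1, Zm1], [Z1]]),
             (28, [(X1, X0), (X0, Z0)], [[Z0], [Y0], [Y1, Ym1], [X1, Xm1, Z1, Zm1]]),
             (5, [], [[Vm1], [Zm1], [Xm1, Ym1], [X1], [Z1]]),
             (2, [(X1, Ym1), (Ym1, Zm1)], [[Vm1], [Zm1], [Xm1], [X0, Y1], [X1, Z1]]),
             (8, [], [[V1], [Z1], [X1, Y1], [Xm1, Ym1], [Zm1]])]))))
       (Leaf 56 [
          (8, [(X1, Ym1)], [[Vm1], [Zm1], [Ym1], [X1]]),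
          (17, [], [[Z0], [X0], [X1, Xm1], [Y1, Ym1]]),
          (10, [(X1, Z1), (X1, Z1), (X1, Z1), (Z1, V1)], [[V1], [Z1], [Y1], [Xm1], [Zm1]]),
          (7, [(X1, X0), (X1, X0), (X0, Z0)], [[Z0], [Y0], [Ym1], [X1, Zm1], [Xm1]])]))
      (Leaf 7 [
         (1, [], [[Z0], [Y0], [Y1, Ym1], [X1, Xm1, Zm1], [Z1]]),
         (1, [], [[Z0], [X0], [X1, Xm1], [Z1, Zm1]]),
         (1, [], [[V1], [Z1], [X1, Y1], [Xm1, Ym1]]),
         (1, [], [[Vm1], [Zm1], [Xm1, Ym1], [X1, Y1]])]))
     (Leaf 16 [
        (1, [(X0, Xm1)], [[Vm1], [Zm1], [Xm1, Ym1], [X1], [Z1]]),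
        (1, [(X0, X1)], [[V1], [Z1], [X1, Y1], [Ym1], [Zm1]]),
        (2, [], [[Z0], [X0], [X1, Xm1], [Y1, Zm1], [Ym1]]),
        (2, [(X0, Z0)], [[Z0], [Y0], [Y1, Ym1], [Xm1, Z1, Zm1], [X1]])]))
    (Leaf 32 [
       (4, [(Z1, Y1)], [[Z0], [X0, Y0], [Xm1, Y1, Ym1], [Zm1]]),
       (6, [], [[V1], [Z1], [Y1], [Xm1, Y0], [Ym1, Zm1]]),
       (2, [], [[Vm1], [Zm1], [Xm1, Ym1], [X1, Y0], [X0, Z1]]),
       (7, [], [[V1], [Z1], [X1], [X0, Ym1], [Xm1, Zm1]])])"

lemma pebbles_suffice_J3_Z0: "pebbles_suffice J3_V J3_adj 12 Z0"
proof (rule J3.pebbles_suffice_if_refutes)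
  show "refutes J3_V J3_adj J3_stabilizer Z0 12 (\<lambda>_. 0) ((\<lambda>_. 12)(Z0 := 0)) certificate_Z0"
    by code_simp
qed (auto simp: J3_stabilizer_def automorphisms_J3 in_J3_V numeral_eq_Suc)

lemma pebbles_suffice_J3_X0: "pebbles_suffice J3_V J3_adj 12 X0"
proof (rule J3.pebbles_suffice_if_refutes)
  show "refutes J3_V J3_adj [id, J3_reflect] X0 12 (\<lambda>_. 0) ((\<lambda>_. 12)(X0 := 0)) certificate_X0"
    by code_simp
qed (auto simp: automorphisms_J3 in_J3_V)

lemma pebbles_suffice_J3_V0: "pebbles_suffice J3_V J3_adj 12 V0"
proof (rule J3.pebbles_suffice_if_refutes)
  show "refutes J3_V J3_adj J3_stabilizer V0 12 (\<lambda>_. 0) ((\<lambda>_. 12)(V0 := 0)) certificate_V0"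
    by code_simp
qed (auto simp: J3_stabilizer_def automorphisms_J3 in_J3_V numeral_eq_Suc)

lemma J3_rotate_orbits: "\<exists>k<6. \<exists>s\<in>{X0, Z0, V0}. v = (J3_rotate ^^ k) s"
  by (cases v) (simp_all add: numeral_eq_Suc Ex_less_Suc)

lemma pebbles_suffice_J3: "pebbles_suffice J3_V J3_adj 12 r"
proof -
  obtain k s where "s \<in> {X0, Z0, V0}" and r: "r = (J3_rotate ^^ k) s"
    using J3_rotate_orbits by blast
  then have "pebbles_suffice J3_V J3_adj 12 s"
    using pebbles_suffice_J3_X0 pebbles_suffice_J3_Z0 pebbles_suffice_J3_V0 by blast
  then show ?thesis
    unfolding r
    by (rule pebbles_suffice_automorphism[OF automorphism_funpow[OF automorphism_J3_rotate] in_J3_V])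
qed

theorem theorem1:
  shows "card J3_V = 12 \<and> pebbling_number J3_V J3_adj = card J3_V"
proof
  show card: "card J3_V = 12"
    by (simp add: J3_V_def)
  show "pebbling_number J3_V J3_adj = card J3_V"
    using J3.finite_V pebbles_suffice_J3 by (simp add: pebbling_number_eq_card card)
qed

end
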